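(* Let $g\ge 1$ be an integer and let $\alpha_0,\ldots,\alpha_g\in\mathbb{C}$. For each $s=1,\ldots,g$ the expression $$H_s(n)=T^{s}_{2g-s+1}(n)+\sum_{j=0}^{s-1} T^{s-j-1}_{2g-s-j}(n+j+1)\,\frac{P_{j,g-j}(n+j)}{\prod_{l=j}^{2g-j-1}u_{n+l}}$$ where $$P_{j,g-j}(n)=\sum_{i=0}^{g-j}\alpha_{j+i}\,P^{i}_{2g-2j-i+1}(n),\qquad j=0,\ldots,g,$$ is an invariant of the recurrence relation $$\prod_{j=0}^{2g}u_{n+j}=\sum_{j=0}^{g}\alpha_j\,T^{j}_{2g-j}(n+1),\qquad n\in\mathbb{Z}.$$ That is, if $(u_n)_{n\in\mathbb{Z}}$ is any sequence of nonzero complex numbers satisfying this recurrence for all $n\in\mathbb{Z}$, then $H_s(n+1)=H_s(n)$ for all $n\in\mathbb{Z}$ and all $s=1,\ldots,g$.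
   Context: For a sequence $(u_n)_{n\in\mathbb{Z}}$ and integers $k\ge 1$, define $$T^k_s(n)=\sum_{0\le\lambda_1<\cdots<\lambda_k\le s-1}\ \prod_{j=1}^k u_{n+\lambda_j+j-1},$$ the sum being over integer tuples $(\lambda_1,\ldots,\lambda_k)$; thus $T^k_s(n)=0$ if $s<k$. Also $T^0_s(n)=1$ for $s\ge 0$. For $k\ge1$, $P^k_s(n)$ is defined by the same sum $\sum\prod_{j=1}^k u_{n+\lambda_j+j-1}$ over tuples $0\le\lambda_1<\cdots<\lambda_k\le s-1$, but omitting all tuples for which both $\lambda_1=0$ and $\lambda_k=s-1$; thus $P^k_s(n)=0$ for $s\le k$. For $k\ge 2$, $s\ge k$ this amounts to $P^k_s(n)=T^k_s(n)-u_nu_{n+k+s-2}T^{k-2}_{s-2}(n+2)$. Also $P^0_s(n)=1$ for $s\ge 1$. *)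

theory Defs
  imports Complex_Main
begin

(* The tuples 0 <= lambda_1 < ... < lambda_k <= s-1.  Lists are indexed from 0,
   so xs ! j is lambda_{j+1}. *)
definition tuples :: "nat \<Rightarrow> nat \<Rightarrow> nat list set" where
  "tuples k s = {xs. length xs = k \<and> sorted_wrt (<) xs \<and> set xs \<subseteq> {..<s}}"

(* The index n + lambda_j + j - 1 (j = 1..k) becomes n + xs ! j + j (j = 0..k-1). *)
definition tuple_prod :: "(int \<Rightarrow> complex) \<Rightarrow> int \<Rightarrow> nat list \<Rightarrow> complex" where
  "tuple_prod u n xs = (\<Prod>j<length xs. u (n + int (xs ! j) + int j))"

definition T :: "(int \<Rightarrow> complex) \<Rightarrow> nat \<Rightarrow> nat \<Rightarrow> int \<Rightarrow> complex" where
  "T u k s n = (\<Sum>xs\<in>tuples k s. tuple_prod u n xs)"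

(* The guard xs = [] makes P u 0 s n = 1.  At s = 0 this value is a convention only. *)
definition P :: "(int \<Rightarrow> complex) \<Rightarrow> nat \<Rightarrow> nat \<Rightarrow> int \<Rightarrow> complex" where
  "P u k s n = (\<Sum>xs\<in>{xs \<in> tuples k s. xs = [] \<or> \<not> (hd xs = 0 \<and> last xs = s - 1)}.
     tuple_prod u n xs)"

(* P_{j,g-j}(n), for j <= g; all subtractions on nat are then exact. *)
definition Psum :: "nat \<Rightarrow> (nat \<Rightarrow> complex) \<Rightarrow> (int \<Rightarrow> complex) \<Rightarrow> nat \<Rightarrow> int \<Rightarrow> complex" where
  "Psum g \<alpha> u j n = (\<Sum>i=0..g - j. \<alpha> (j + i) * P u i (2 * g - 2 * j - i + 1) n)"

(* H_s(n), for 1 <= s <= g; all subtractions on nat are then exact. *)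
definition H :: "nat \<Rightarrow> (nat \<Rightarrow> complex) \<Rightarrow> (int \<Rightarrow> complex) \<Rightarrow> nat \<Rightarrow> int \<Rightarrow> complex" where
  "H g \<alpha> u s n = T u s (2 * g - s + 1) n +
     (\<Sum>j=0..s - 1. T u (s - j - 1) (2 * g - s - j) (n + int j + 1) *
        (Psum g \<alpha> u j (n + int j) / (\<Prod>l=j..2 * g - j - 1. u (n + int l))))"

definition satisfies_recurrence :: "nat \<Rightarrow> (nat \<Rightarrow> complex) \<Rightarrow> (int \<Rightarrow> complex) \<Rightarrow> bool" where
  "satisfies_recurrence g \<alpha> u \<longleftrightarrow>
     (\<forall>n. (\<Prod>j=0..2 * g. u (n + int j)) = (\<Sum>j=0..g. \<alpha> j * T u j (2 * g - j) (n + 1)))"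

end

theory Submission
  imports Defs
begin

text \<open>
  Shifting by \<open>j - 1\<close> turns strictly increasing tuples into sets without adjacent elements:
  \<open>T\<^sup>k\<^sub>s(n)\<close> sums over the \<open>k\<close>-element such subsets of a window of \<open>s + k - 1\<close> consecutive indices, and
  \<open>P\<^sup>k\<^sub>s(n)\<close> over those that are also independent when the window is closed up to a cycle. Splitting off
  the first or the last index of the window gives two expansions of each. With
  \<open>r\<^sub>j = \<Sum>\<^sub>i \<alpha>\<^sub>j\<^sub>+\<^sub>i T\<^sup>i\<^sub>2\<^sub>g\<^sub>-\<^sub>2\<^sub>j\<^sub>-\<^sub>i(n + j + 1)\<close>, the numerator of the \<open>j\<close>-th summand is
  \<open>r\<^sub>j + u\<^sub>n\<^sub>+\<^sub>j r\<^sub>j\<^sub>+\<^sub>1\<close> in \<open>H\<^sub>s(n)\<close> and \<open>r\<^sub>j + u\<^sub>n\<^sub>+\<^sub>2\<^sub>g\<^sub>-\<^sub>j r\<^sub>j\<^sub>+\<^sub>1\<close> in \<open>H\<^sub>s(n + 1)\<close>. The recurrence evaluates \<open>r\<^sub>0\<close>,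
  and the sum for \<open>H\<^sub>s(n + 1) - H\<^sub>s(n)\<close> then telescopes to zero.
\<close>

section \<open>Increasing tuples and their products\<close>

lemma finite_tuples [simp]: "finite (tuples k s)"
proof (rule finite_subset)
  show "tuples k s \<subseteq> {xs. set xs \<subseteq> {..<s} \<and> length xs = k}"
    by (auto simp: tuples_def)
qed (simp add: finite_lists_length_eq)

lemma tuples_0 [simp]: "tuples 0 s = {[]}"
  by (auto simp: tuples_def)

lemma tuple_prod_Cons:
  "tuple_prod u n (x # xs) = u (n + int x) * tuple_prod u (n + 1) xs"
  by (simp add: tuple_prod_def prod.lessThan_Suc_shift add_ac del: prod.lessThan_Suc)

lemma tuple_prod_snoc:
  "tuple_prod u n (xs @ [x]) = tuple_prod u n xs * u (n + int x + int (length xs))"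
  by (simp add: tuple_prod_def nth_append)

lemma tuple_prod_map_Suc: "tuple_prod u n (map Suc xs) = tuple_prod u (n + 1) xs"
  by (simp add: tuple_prod_def algebra_simps)

lemma T_0 [simp]: "T u 0 s n = 1"
  by (simp add: T_def tuple_prod_def)

lemma P_0 [simp]: "P u 0 s n = 1"
proof -
  have "{xs \<in> tuples 0 s. xs = [] \<or> \<not> (hd xs = 0 \<and> last xs = s - 1)} = {[]}"
    by auto
  then show ?thesis
    by (simp add: P_def tuple_prod_def)
qed

lemma length_tuples: "xs \<in> tuples k s \<Longrightarrow> length xs = k"
  by (simp add: tuples_def)

lemma snoc_in_tuples:
  "xs @ [x] \<in> tuples (Suc k) s \<longleftrightarrow> x < s \<and> xs \<in> tuples k x"
  by (auto simp: tuples_def sorted_wrt_append)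

lemma map_Suc_in_tuples [simp]:
  "map Suc xs \<in> tuples k (Suc s) \<longleftrightarrow> xs \<in> tuples k s"
  by (auto simp: tuples_def sorted_wrt_map)

lemma map_Suc_if_pos:
  assumes "0 \<notin> set xs"
  obtains ys where "xs = map Suc ys"
proof
  show "xs = map Suc (map (\<lambda>x. x - 1) xs)"
    using assms by (induction xs) auto
qed

lemma Cons_map_Suc_in_tuples [simp]:
  "0 # map Suc xs \<in> tuples (Suc k) (Suc s) \<longleftrightarrow> xs \<in> tuples k s"
  by (auto simp: tuples_def sorted_wrt_map)

lemma tuples_tail:
  assumes "x # xs \<in> tuples (Suc k) (Suc s)"
  obtains ys where "xs = map Suc ys" "ys \<in> tuples k s"
proof -
  have "0 \<notin> set xs" "xs \<in> tuples k (Suc s)"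
    using assms by (auto simp: tuples_def)
  then show thesis
    using that map_Suc_if_pos map_Suc_in_tuples by metis
qed

lemma tuples_hd_pos:
  assumes "xs \<in> tuples (Suc k) (Suc s)" "hd xs \<noteq> 0"
  obtains ys where "xs = map Suc ys" "ys \<in> tuples (Suc k) s"
proof -
  have "0 \<notin> set xs"
    using assms by (cases xs) (auto simp: tuples_def)
  then show thesis
    using assms(1) that map_Suc_if_pos map_Suc_in_tuples by metis
qed

section \<open>Shifted and extended tuples, and the two expansions of \<open>T\<close>\<close>

lemma sum_over_shifted:
  "sum (tuple_prod u n) (map Suc ` tuples k s) = T u k s (n + 1)"
proof -
  have "inj_on (map Suc) (tuples k s)"
    by (rule inj_onI) simp
  then show ?thesis
    by (simp add: sum.reindex T_def tuple_prod_map_Suc)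
qed

text \<open>The base point moves by two: by one because each entry of \<open>xs\<close> stands one
  position further right, and by one because of \<open>Suc\<close>.\<close>

lemma sum_over_Cons:
  "sum (tuple_prod u n) ((\<lambda>xs. 0 # map Suc xs) ` tuples k s) = u n * T u k s (n + 2)"
proof -
  have "inj_on (\<lambda>xs. 0 # map Suc xs) (tuples k s)"
    by (rule inj_onI) simp
  then show ?thesis
    by (simp add: sum.reindex T_def tuple_prod_Cons tuple_prod_map_Suc sum_distrib_left add.assoc)
qed

lemma sum_over_snoc:
  "sum (tuple_prod u n) ((\<lambda>xs. xs @ [x]) ` tuples k s) = u (n + int x + int k) * T u k s n"
proof -
  have "inj_on (\<lambda>xs. xs @ [x]) (tuples k s)"
    by (rule inj_onI) simp
  then show ?thesis
    by (simp add: sum.reindex T_def tuple_prod_snoc length_tuples sum_distrib_right mult.commute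
        cong: sum.cong)
qed

text \<open>Cases on the first entry: if it is positive, all entries can be lowered by one; if it is
  0, it is dropped and the others, being positive, are lowered.\<close>

lemma T_Suc_left:
  "T u (Suc k) (Suc s) n = T u (Suc k) s (n + 1) + u n * T u k s (n + 2)"
proof -
  have "tuples (Suc k) (Suc s) =
      map Suc ` tuples (Suc k) s \<union> (\<lambda>xs. 0 # map Suc xs) ` tuples k s" (is "_ = ?A \<union> ?B")
  proof (intro equalityI subsetI)
    fix xs assume xs: "xs \<in> tuples (Suc k) (Suc s)"
    show "xs \<in> ?A \<union> ?B"
    proof (cases "hd xs = 0")
      case True
      then obtain ys where ys: "xs = 0 # ys"
        using xs by (cases xs) (auto simp: tuples_def)
      obtain zs where "ys = map Suc zs" "zs \<in> tuples k s"
        using xs unfolding ys by (rule tuples_tail)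
      with ys show ?thesis
        by simp
    next
      case False
      with xs obtain ys where "xs = map Suc ys" "ys \<in> tuples (Suc k) s"
        by (rule tuples_hd_pos)
      then show ?thesis
        by simp
    qed
  qed auto
  moreover have "?A \<inter> ?B = {}"
    by (auto simp: tuples_def)
  ultimately show ?thesis
    by (simp add: T_def[of u "Suc k" "Suc s"] sum.union_disjoint sum_over_shifted sum_over_Cons)
qed

text \<open>The last entry is the largest, so a tuple not ending in \<open>s\<close> lies entirely
  below \<open>s\<close>.\<close>

lemma T_Suc_right:
  "T u (Suc k) (Suc s) n = T u (Suc k) s n + u (n + int s + int k) * T u k s n"
proof -
  have "tuples (Suc k) (Suc s) = tuples (Suc k) s \<union> (\<lambda>xs. xs @ [s]) ` tuples k s" (is "_ = ?A \<union> ?B")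
  proof (intro equalityI subsetI)
    fix xs assume xs: "xs \<in> tuples (Suc k) (Suc s)"
    then show "xs \<in> ?A \<union> ?B"
      by (cases xs rule: rev_cases) (auto simp: snoc_in_tuples less_Suc_eq dest: length_tuples)
  qed (auto simp: snoc_in_tuples, auto simp: tuples_def)
  moreover have "?A \<inter> ?B = {}"
    by (auto simp: snoc_in_tuples)
  ultimately show ?thesis
    by (simp add: T_def[of u "Suc k" "Suc s"] sum.union_disjoint sum_over_snoc)
       (simp add: T_def)
qed

text \<open>Expanding at \<open>n\<close> on the left and at \<open>n + 1\<close> on the right
  leaves the same remainder \<open>T u (Suc k) s (n + 1)\<close>, which cancels. Each step of the
  telescoping uses this identity.\<close>

lemma T_shift_diff:
  "T u (Suc k) (Suc s) (n + 1) - T u (Suc k) (Suc s) n =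
     u (n + 1 + int s + int k) * T u k s (n + 1) - u n * T u k s (n + 2)"
  using T_Suc_left[of u k s n] T_Suc_right[of u k s "n + 1"] by simp

section \<open>The two expansions of \<open>P\<close>\<close>

lemma last_tuples_less:
  assumes "xs \<in> tuples (Suc k) s" shows "last xs < s"
  using assms by (cases xs rule: rev_cases) (auto simp: snoc_in_tuples dest: length_tuples)

lemma tuples_mono: "xs \<in> tuples k s \<Longrightarrow> s \<le> t \<Longrightarrow> xs \<in> tuples k t"
  by (auto simp: tuples_def)

lemma in_tuples_Suc_if_last:
  assumes "xs \<in> tuples (Suc k) (Suc s)" "last xs \<noteq> s"
  shows "xs \<in> tuples (Suc k) s"
  using assms by (cases xs rule: rev_cases) (auto simp: snoc_in_tuples dest: length_tuples)

text \<open>Cases on the first entry, as for \<open>T\<close>. If it is 0, the omission rule forbids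
  the last entry \<open>Suc s\<close>, so the bound on the entries drops by one before the 0 is
  removed.\<close>

lemma P_Suc_left:
  "P u (Suc k) (Suc (Suc s)) n = T u (Suc k) (Suc s) (n + 1) + u n * T u k s (n + 2)"
proof -
  have "{xs \<in> tuples (Suc k) (Suc (Suc s)). xs = [] \<or> \<not> (hd xs = 0 \<and> last xs = Suc (Suc s) - 1)} =
      map Suc ` tuples (Suc k) (Suc s) \<union> (\<lambda>xs. 0 # map Suc xs) ` tuples k s" (is "?S = ?A \<union> ?B")
  proof (intro equalityI subsetI)
    fix xs assume xs: "xs \<in> ?S"
    then have xs_ne: "xs \<noteq> []"
      by (auto simp: tuples_def)
    show "xs \<in> ?A \<union> ?B"
    proof (cases "hd xs = 0")
      case True
      then obtain ys where ys: "xs = 0 # ys"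
        using xs_ne by (cases xs) auto
      have "xs \<in> tuples (Suc k) (Suc s)"
        using True xs xs_ne by (simp add: in_tuples_Suc_if_last)
      then obtain zs where "ys = map Suc zs" "zs \<in> tuples k s"
        unfolding ys by (rule tuples_tail)
      with ys show ?thesis
        by simp
    next
      case False
      have "xs \<in> tuples (Suc k) (Suc (Suc s))"
        using xs by simp
      then obtain ys where "xs = map Suc ys" "ys \<in> tuples (Suc k) (Suc s)"
        using False by (rule tuples_hd_pos)
      then show ?thesis
        by simp
    qed
  next
    fix xs assume "xs \<in> ?A \<union> ?B"
    then consider (A) ys where "xs = map Suc ys" "ys \<in> tuples (Suc k) (Suc s)"
      | (B) ys where "xs = 0 # map Suc ys" "ys \<in> tuples k s"
      by auto
    then show "xs \<in> ?S"
    proof cases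
      case A
      then show ?thesis
        by (cases ys) (auto simp: tuples_def sorted_wrt_map)
    next
      case B
      \<comment> \<open>The smaller bound keeps the last entry below \<open>Suc s\<close>, so this
        tuple is not among the omitted ones.\<close>
      then have "xs \<in> tuples (Suc k) (Suc s)"
        by simp
      with last_tuples_less[OF this] show ?thesis
        using tuples_mono[of xs "Suc k" "Suc s" "Suc (Suc s)"] by simp
    qed
  qed
  moreover have "?A \<inter> ?B = {}"
    by (auto simp: tuples_def)
  ultimately show ?thesis
    by (simp add: P_def sum.union_disjoint sum_over_shifted sum_over_Cons)
qed

text \<open>No second case analysis on tuples: the expansions of \<open>T\<close> convert the left
  form into this one.\<close>

lemma P_Suc_right:
  "P u (Suc k) (Suc (Suc s)) n =
     T u (Suc k) (Suc s) n + u (n + int s + int k + 1) * T u k s (n + 1)"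
  using T_Suc_left[of u k s n] T_Suc_right[of u k s "n + 1"] T_Suc_right[of u k s n]
    P_Suc_left[of u k s n]
  by (simp add: algebra_simps)

section \<open>The numerators in terms of \<open>T\<close>\<close>

definition R :: "nat \<Rightarrow> (nat \<Rightarrow> complex) \<Rightarrow> (int \<Rightarrow> complex) \<Rightarrow> nat \<Rightarrow> int \<Rightarrow> complex" where
  "R g \<alpha> u j m = (\<Sum>i=0..g - j. \<alpha> (j + i) * T u i (2 * g - 2 * j - i) m)"

text \<open>The premise on \<open>P\<close> is the common shape of its left and right expansions, so
  one computation serves both. \<open>R\<close> at \<open>j\<close> is the right-hand side of the
  recurrence with \<open>g - j\<close> for \<open>g\<close> and coefficients shifted by
  \<open>j\<close>.\<close>

lemma Psum_eq_R:
  assumes j: "j < g"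
    and P: "\<And>k s. s + k + 2 = 2 * g - 2 * j \<Longrightarrow>
      P u (Suc k) (Suc (Suc s)) n = T u (Suc k) (Suc s) m + c * T u k s m'"
  shows "Psum g \<alpha> u j n = R g \<alpha> u j m + c * R g \<alpha> u (Suc j) m'"
proof -
  define d where "d = g - Suc j"
  have d: "g - j = Suc d" "2 * g - 2 * j = Suc (Suc (2 * d))" "2 * g - 2 * Suc j = 2 * d"
    using j by (auto simp: d_def)
  have *: "P u (Suc i) (Suc (Suc (2 * d - i))) n =
      T u (Suc i) (Suc (2 * d - i)) m + c * T u i (2 * d - i) m'" if "i \<le> d" for i
    using that d by (intro P) auto
  have "Psum g \<alpha> u j n =
      \<alpha> j + (\<Sum>i=0..d. \<alpha> (Suc (j + i)) * P u (Suc i) (Suc (Suc (2 * d - i))) n)"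
    unfolding Psum_def d sum.atLeast0_atMost_Suc_shift
    by (auto simp: Suc_diff_le intro!: sum.cong)
  also have "\<dots> = \<alpha> j + (\<Sum>i=0..d. \<alpha> (Suc (j + i)) *
      (T u (Suc i) (Suc (2 * d - i)) m + c * T u i (2 * d - i) m'))"
    by (simp add: *)
  also have "\<dots> = \<alpha> j + (\<Sum>i=0..d. \<alpha> (Suc (j + i)) * T u (Suc i) (Suc (2 * d - i)) m) +
      c * (\<Sum>i=0..d. \<alpha> (Suc (j + i)) * T u i (2 * d - i) m')"
    by (simp add: distrib_left sum.distrib sum_distrib_left mult.left_commute)
  \<comment> \<open>The isolated \<open>\<alpha> j\<close>, which came from
    \<open>P u 0 = 1\<close>, is the term \<open>i = 0\<close> of \<open>R\<close>, because
    \<open>T u 0 = 1\<close> too.\<close>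
  also have "\<alpha> j + (\<Sum>i=0..d. \<alpha> (Suc (j + i)) * T u (Suc i) (Suc (2 * d - i)) m) = R g \<alpha> u j m"
    unfolding R_def d sum.atLeast0_atMost_Suc_shift
    by (auto simp: Suc_diff_le intro!: sum.cong)
  also have "(\<Sum>i=0..d. \<alpha> (Suc (j + i)) * T u i (2 * d - i) m') = R g \<alpha> u (Suc j) m'"
    unfolding R_def d by (simp add: d_def)
  finally show ?thesis .
qed

lemma Psum_left:
  assumes "j < g"
  shows "Psum g \<alpha> u j n = R g \<alpha> u j (n + 1) + u n * R g \<alpha> u (Suc j) (n + 2)"
  using assms by (rule Psum_eq_R) (rule P_Suc_left)

lemma Psum_right:
  assumes "j < g"
  shows "Psum g \<alpha> u j n =
    R g \<alpha> u j n + u (n + int (2 * g - 2 * j - 1)) * R g \<alpha> u (Suc j) (n + 1)"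
proof (rule Psum_eq_R[OF assms])
  fix k s assume "s + k + 2 = 2 * g - 2 * j"
  then have "2 * g - 2 * j - 1 = s + k + 1"
    by simp
  then show "P u (Suc k) (Suc (Suc s)) n = T u (Suc k) (Suc s) n +
      u (n + int (2 * g - 2 * j - 1)) * T u k s (n + 1)"
    by (simp add: P_Suc_right algebra_simps)
qed

section \<open>The telescoping sum\<close>

lemma H_invariant:
  assumes s: "1 \<le> s" "s \<le> g"
    and u: "\<And>n. u n \<noteq> 0"
    and rec: "satisfies_recurrence g \<alpha> u"
  shows "H g \<alpha> u s (n + 1) = H g \<alpha> u s n"
proof -
  define a where "a j = u (n + int j)" for j
  define b where "b j = u (n + int (2 * g - j))" for j
  \<comment> \<open>The factors strictly between \<open>a j\<close> and \<open>b j\<close>; removing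
    the two outermost ones gives \<open>p (Suc j)\<close>.\<close>
  define p where "p j = (\<Prod>l=j+1..2 * g - j - 1. u (n + int l))" for j
  define r where "r j = R g \<alpha> u j (n + int j + 1)" for j
  define X where "X j = T u (s - j - 1) (2 * g - s - j) (n + int j + 1)" for j
  define Y where "Y j = T u (s - j - 1) (2 * g - s - j) (n + int j + 2)" for j
  \<comment> \<open>The difference with its sum cut off after \<open>j\<close> summands; at
    \<open>j = s\<close> it is complete.\<close>
  define D where "D j = T u s (2 * g - s + 1) (n + 1) - T u s (2 * g - s + 1) n +
    (\<Sum>i<j. Y i * (Psum g \<alpha> u i (n + 1 + int i) / (\<Prod>l=i..2 * g - i - 1. u (n + 1 + int l)))
      - X i * (Psum g \<alpha> u i (n + int i) / (\<Prod>l=i..2 * g - i - 1. u (n + int l))))" for j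

  have nz: "a j \<noteq> 0" "b j \<noteq> 0" "p j \<noteq> 0" for j
    by (auto simp: a_def b_def p_def u)
  have prod_left: "(\<Prod>l=j..2 * g - j - 1. u (n + int l)) = a j * p j" if "j < g" for j
    using that by (simp add: a_def p_def prod.atLeast_Suc_atMost)
  have prod_right: "(\<Prod>l=j..2 * g - j - 1. u (n + 1 + int l)) = p j * b j" if "j < g" for j
  proof -
    have "(\<Prod>l=j..2 * g - j - 1. u (n + 1 + int l)) = (\<Prod>l=Suc j..Suc (2 * g - j - 1). u (n + int l))"
      unfolding prod.shift_bounds_cl_Suc_ivl by (simp add: algebra_simps)
    also have "\<dots> = p j * u (n + int (Suc (2 * g - j - 1)))"
      using that by (subst prod.cl_ivl_Suc) (auto simp: p_def)
    also have "Suc (2 * g - j - 1) = 2 * g - j"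
      using that by simp
    finally show ?thesis
      by (simp add: b_def)
  qed
  have p_Suc: "p j = a (Suc j) * b (Suc j) * p (Suc j)" if "Suc j < g" for j
  proof -
    have "p j = a (Suc j) * (\<Prod>l=Suc (Suc j)..Suc (2 * g - Suc j - 1). u (n + int l))"
      using that by (simp add: p_def a_def prod.atLeast_Suc_atMost Suc_diff_Suc numeral_2_eq_2)
    also have "\<dots> = a (Suc j) * (p (Suc j) * u (n + int (Suc (2 * g - Suc j - 1))))"
      using that by (subst prod.cl_ivl_Suc) (auto simp: p_def)
    also have "Suc (2 * g - Suc j - 1) = 2 * g - Suc j"
      using that by simp
    finally show ?thesis
      by (simp add: b_def)
  qed
  have r_0: "r 0 = a 0 * b 0 * p 0"
  proof -
    have "r 0 = (\<Prod>j=0..2 * g. u (n + int j))"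
      using rec by (simp add: r_def R_def satisfies_recurrence_def)
    also have "\<dots> = a 0 * (\<Prod>j=Suc 0..Suc (2 * g - 1). u (n + int j))"
      using s by (simp add: a_def prod.atLeast_Suc_atMost)
    also have "\<dots> = a 0 * (p 0 * u (n + int (Suc (2 * g - 1))))"
      using s by (subst prod.cl_ivl_Suc) (auto simp: p_def)
    also have "Suc (2 * g - 1) = 2 * g"
      using s by simp
    finally show ?thesis
      by (simp add: b_def)
  qed
  have Psum_0: "Psum g \<alpha> u j (n + int j) = r j + a j * r (Suc j)" if "j < g" for j
    using Psum_left[OF that, of \<alpha> u "n + int j"] by (simp add: r_def a_def algebra_simps)
  have Psum_1: "Psum g \<alpha> u j (n + 1 + int j) = r j + b j * r (Suc j)" if "j < g" for j
  proof -
    have "n + 1 + int j + int (2 * g - 2 * j - 1) = n + int (2 * g - j)"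
      using that by simp
    then show ?thesis
      using Psum_right[OF that, of \<alpha> u "n + 1 + int j"]
      by (simp add: r_def b_def algebra_simps)
  qed
  have D_Suc: "D (Suc j) = D j + Y j * (r j / (p j * b j) + r (Suc j) / p j)
      - X j * (r j / (a j * p j) + r (Suc j) / p j)" if "j < g" for j
    using nz[of j]
    unfolding D_def sum.lessThan_Suc prod_left[OF that] prod_right[OF that]
      Psum_0[OF that] Psum_1[OF that]
    by (simp add: add_divide_distrib)
  \<comment> \<open>With this value of \<open>D j\<close>, all terms containing \<open>r j\<close>
    in \<open>D_Suc\<close> cancel.\<close>
  have D_step: "D (Suc j) = (Y j - X j) * (r (Suc j) / p j)"
    if "j < g" "D j = r j / p j * (X j / a j - Y j / b j)" for j
    by (simp add: D_Suc[OF that(1)] that(2) algebra_simps diff_divide_distrib)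
  have YX: "Y j - X j = b (Suc j) * X (Suc j) - a (Suc j) * Y (Suc j)" if "Suc j < s" for j
  proof -
    define k t where "k = s - j - 2" and "t = 2 * g - s - j - 1"
    have kt: "s - j - 1 = Suc k" "2 * g - s - j = Suc t" "s - Suc j - 1 = k" "2 * g - s - Suc j = t"
      and end_index: "n + int j + 1 + 1 + int t + int k = n + int (2 * g - Suc j)"
      using that s by (auto simp: k_def t_def)
    have "n + int (Suc j) = n + int j + 1" "n + int j + 2 = n + int j + 1 + 1"
      "n + int (Suc j) + 2 = n + int j + 1 + 2"
      by simp_all
    then show ?thesis
      using T_shift_diff[of u k t "n + int j + 1"]
      unfolding X_def Y_def a_def b_def kt end_index by metis
  qed
  have D_eq: "D j = r j / p j * (X j / a j - Y j / b j)" if "j < s" for j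
    using that
  proof (induction j)
    case 0
    obtain k t where kt: "s = Suc k" "2 * g - s = t"
      using s by (cases s) auto
    then have end_index: "n + 1 + int t + int k = n + int (2 * g)"
      using s by auto
    have "D 0 = b 0 * X 0 - a 0 * Y 0"
      using T_shift_diff[of u k t n, unfolded end_index] kt
      by (simp add: D_def a_def b_def X_def Y_def)
    then show ?case
      using nz[of 0] by (simp add: r_0 right_diff_distrib)
  next
    case (Suc j)
    then have "D (Suc j) = (Y j - X j) * (r (Suc j) / p j)"
      using D_step[of j] s by simp
    \<comment> \<open>\<open>YX\<close> brings in the factors \<open>b (Suc j)\<close> and
      \<open>a (Suc j)\<close>; dividing by \<open>p j\<close>, which contains both, leaves the
      other one in each denominator.\<close>
    also have "\<dots> = r (Suc j) / p (Suc j) * (X (Suc j) / a (Suc j) - Y (Suc j) / b (Suc j))"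
      using YX[of j] p_Suc[of j] Suc.prems s nz[of "Suc j"]
      by (simp add: diff_divide_distrib left_diff_distrib right_diff_distrib mult.commute)
    finally show ?case .
  qed
  obtain k where k: "s = Suc k"
    using s by (cases s) auto
  \<comment> \<open>At the last index both have order 0 and equal 1, so the factor
    \<open>Y k - X k\<close> in \<open>D_step\<close> vanishes.\<close>
  have "X k = Y k"
    by (simp add: X_def Y_def k)
  then have "D s = 0"
    using D_step[of k] D_eq[of k] s k by simp
  moreover have "H g \<alpha> u s (n + 1) - H g \<alpha> u s n = D s"
  proof -
    have "{0..s - 1} = {..<s}"
      using s by auto
    then show ?thesis
      by (simp add: H_def D_def X_def Y_def sum_subtractf algebra_simps)
  qed
  ultimately show ?thesis
    by simp
qed

theorem theorem2p12:
  fixes g :: nat and \<alpha> :: "nat \<Rightarrow> complex" and u :: "int \<Rightarrow> complex"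
  assumes "g \<ge> 1"
    and "\<forall>n. u n \<noteq> 0"
    and "satisfies_recurrence g \<alpha> u"
  shows "\<forall>s\<in>{1..g}. \<forall>n. H g \<alpha> u s (n + 1) = H g \<alpha> u s n"
  using assms by (auto intro: H_invariant)

end
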